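(* Let $\mathbb{F}_q$ be a finite field with $q$ elements, let $n,k$ be integers with $n>k\geq 2$, and let $\mathcal{C}$ be an $[n,k]$ linear code over $\mathbb{F}_q$, i.e., a $k$-dimensional $\mathbb{F}_q$-linear subspace of $\mathbb{F}_q^n$. Then the minimum insdel distance of $\mathcal{C}$ satisfies $$d(\mathcal{C})\leq 2n-2k.$$
   Context: For $\mathbf{a},\mathbf{b}\in\mathbb{F}_q^n$, the insdel distance $d(\mathbf{a},\mathbf{b})$ is the minimum number of insertions and deletions (of single symbols of $\mathbb{F}_q$) needed to transform $\mathbf{a}$ into $\mathbf{b}$. (It is a known fact that $d(\mathbf{a},\mathbf{b})=2n-2\ell$, where $\ell$ is the length of a longest common subsequence of $\mathbf{a}$ and $\mathbf{b}$.) The minimum insdel distance of a linear code $\mathcal{C}\subseteq\mathbb{F}_q^n$ is $d(\mathcal{C})=\min\{d(\mathbf{c}_1,\mathbf{c}_2) : \mathbf{c}_1,\mathbf{c}_2\in\mathcal{C},\ \mathbf{c}_1\neq\mathbf{c}_2\}$. *)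

theory Defs
  imports "Jordan_Normal_Form.VS_Connect"
begin

inductive insdel_step :: "'a list \<Rightarrow> 'a list \<Rightarrow> bool" where
  insertion: "insdel_step (xs @ ys) (xs @ [a] @ ys)"
| deletion: "insdel_step (xs @ [a] @ ys) (xs @ ys)"

definition insdel_dist :: "'a list \<Rightarrow> 'a list \<Rightarrow> nat" where
  "insdel_dist xs ys = (LEAST m. (insdel_step ^^ m) xs ys)"

(* Any two words are connected by insertions and deletions, so the LEAST above is attained. *)
lemma insdel_dist_attained: "(insdel_step ^^ insdel_dist xs ys) xs ys"
proof -
  have del: "insdel_step\<^sup>*\<^sup>* us []" for us :: "'a list"
  proof (induction us)
    case (Cons a us)
    have "insdel_step (a # us) us"
      using insdel_step.deletion[of "[]" a us] by simp
    then show ?case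
      using Cons.IH by (rule converse_rtranclp_into_rtranclp)
  qed simp
  have ins: "insdel_step\<^sup>*\<^sup>* [] us" for us :: "'a list"
  proof (induction us)
    case (Cons a us)
    have "insdel_step us (a # us)"
      using insdel_step.insertion[of "[]" us a] by simp
    with Cons.IH show ?case
      by (rule rtranclp.rtrancl_into_rtrancl)
  qed simp
  have "insdel_step\<^sup>*\<^sup>* xs ys"
    using del[of xs] ins[of ys] by (rule rtranclp_trans)
  then obtain m where "(insdel_step ^^ m) xs ys"
    by (auto dest: rtranclp_imp_relpowp)
  then show ?thesis
    unfolding insdel_dist_def by (rule LeastI)
qed

definition linear_code :: "nat \<Rightarrow> nat \<Rightarrow> 'a::field vec set \<Rightarrow> bool" where
  "linear_code n k C \<longleftrightarrow>
     VectorSpace.subspace class_ring C (module_vec TYPE('a) n) \<and>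
     vectorspace.dim class_ring (module_vec TYPE('a) n\<lparr>carrier := C\<rparr>) = k"

(* On nat, Inf of a nonempty set is its minimum; the set below is nonempty
   exactly when C has at least two codewords. *)
definition min_insdel_dist :: "'a vec set \<Rightarrow> nat" where
  "min_insdel_dist C =
     Inf {insdel_dist (list_of_vec c1) (list_of_vec c2) | c1 c2. c1 \<in> C \<and> c2 \<in> C \<and> c1 \<noteq> c2}"

end

theory Submission
  imports Defs "HOL-Library.Cardinality"
begin

text \<open>
  A code with \<open>q ^ k\<close> words is handled by counting alone. If two codewords share their first \<open>k\<close>
  symbols, these form a common subsequence of length \<open>k\<close>. Otherwise taking the prefix of length
  \<open>k\<close> is a bijection from the code onto all words of length \<open>k\<close>, so for every codeword \<open>c\<close> there is a
  codeword \<open>c'\<close> whose prefix is the window \<open>c\<^sub>2 \<dots> c\<^sub>k\<^sub>+\<^sub>1\<close> of \<open>c\<close>. If \<open>c' = c\<close> for all \<open>c\<close>, every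
  codeword is constant on its first \<open>k + 1\<close> positions, leaving only \<open>q < q ^ k\<close> prefixes. So \<open>c' \<noteq> c\<close>
  for some \<open>c\<close>, and again there is a common subsequence of length \<open>k\<close>.
\<close>

lemma insdel_dist_le: "(insdel_step ^^ m) xs ys \<Longrightarrow> insdel_dist xs ys \<le> m"
  unfolding insdel_dist_def by (rule Least_le)

lemma relpowp_insdel_step_delete: "(insdel_step ^^ length xs) (us @ xs @ vs) (us @ vs)"
proof (induction xs)
  case (Cons a xs)
  have "insdel_step (us @ (a # xs) @ vs) (us @ xs @ vs)"
    using insdel_step.deletion[of us a "xs @ vs"] by simp
  with Cons.IH show ?case
    unfolding length_Cons by (intro relpowp_Suc_I2)
qed simp

lemma relpowp_insdel_step_insert: "(insdel_step ^^ length xs) (us @ vs) (us @ xs @ vs)"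
proof (induction xs)
  case (Cons a xs)
  have "insdel_step (us @ xs @ vs) (us @ (a # xs) @ vs)"
    using insdel_step.insertion[of us "xs @ vs" a] by simp
  with Cons.IH show ?case
    unfolding length_Cons by (intro relpowp_Suc_I)
qed simp

text \<open>Delete \<open>us\<close> and \<open>vs\<close> until only \<open>ws\<close> is left,
  then build \<open>us'\<close> and \<open>vs'\<close> around it. The summands follow the order of
  these four phases, so \<open>relpowp_add\<close> splits the path accordingly.\<close>

lemma insdel_dist_common_infix:
  "insdel_dist (us @ ws @ vs) (us' @ ws @ vs')
     \<le> length us + length vs + length us' + length vs'"
proof -
  have 1: "(insdel_step ^^ length us) (us @ ws @ vs) (ws @ vs)"
    using relpowp_insdel_step_delete[of us "[]" "ws @ vs"] by simp
  have 2: "(insdel_step ^^ length vs) (ws @ vs) ws"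
    using relpowp_insdel_step_delete[of vs ws "[]"] by simp
  have 3: "(insdel_step ^^ length us') ws (us' @ ws)"
    using relpowp_insdel_step_insert[of us' "[]" ws] by simp
  have 4: "(insdel_step ^^ length vs') (us' @ ws) (us' @ ws @ vs')"
    using relpowp_insdel_step_insert[of vs' "us' @ ws" "[]"] by simp
  show ?thesis
    by (rule insdel_dist_le) (use 1 2 3 4 in \<open>auto simp: relpowp_add intro!: relcomppI\<close>)
qed

lemma insdel_dist_common_window:
  assumes "length xs = n" "length ys = n" "i + k \<le> n" "j + k \<le> n"
    and window: "take k (drop i xs) = take k (drop j ys)"
  shows "insdel_dist xs ys \<le> 2 * n - 2 * k"
proof -
  have split: "take m zs @ take k (drop m zs) @ drop (m + k) zs = zs" for zs :: "'a list" and m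
    by (metis add.commute append_take_drop_id drop_drop)
  have "insdel_dist xs ys \<le> length (take i xs) + length (drop (i + k) xs)
      + length (take j ys) + length (drop (j + k) ys)"
    using insdel_dist_common_infix[of "take i xs" "take k (drop i xs)" "drop (i + k) xs"
        "take j ys" "drop (j + k) ys"]
    \<comment> \<open>The order matters: the first \<open>split\<close> reassembles
      \<open>xs\<close>; only then is the shared window rewritten as a window of \<open>ys\<close>,
      so that the second \<open>split\<close> reassembles \<open>ys\<close>.\<close>
    unfolding split unfolding window split .
  also have "\<dots> = 2 * n - 2 * k"
    using assms(1-4) by simp
  finally show ?thesis .
qed

lemma exists_insdel_dist_le:
  fixes L :: "'a::finite list set"
  assumes "2 \<le> k" "k < n" "2 \<le> CARD('a)"
    and len: "\<And>xs. xs \<in> L \<Longrightarrow> length xs = n"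
    and card_L: "card L = CARD('a) ^ k"
  shows "\<exists>xs\<in>L. \<exists>ys\<in>L. xs \<noteq> ys \<and> insdel_dist xs ys \<le> 2 * n - 2 * k"
proof (cases "inj_on (take k) L")
  case False
  then obtain xs ys where "xs \<in> L" "ys \<in> L" "xs \<noteq> ys" "take k xs = take k ys"
    unfolding inj_on_def by blast
  then show ?thesis
    using insdel_dist_common_window[of xs n ys 0 k 0] len \<open>k < n\<close> by auto
next
  case inj: True
  let ?W = "{ws :: 'a list. length ws = k}"
  have fin_W: "finite ?W" and card_W: "card ?W = CARD('a) ^ k"
    using finite_lists_length_eq[of "UNIV :: 'a set" k]
      card_lists_length_eq[of "UNIV :: 'a set" k] by auto
  have "take k ` L \<subseteq> ?W"
    using len \<open>k < n\<close> by auto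
  then have surj: "take k ` L = ?W"
    using card_subset_eq[OF fin_W] card_image[OF inj] card_L card_W by simp
  have "\<exists>xs\<in>L. take k (drop 1 xs) \<noteq> take k xs"
  proof (rule ccontr)
    assume "\<not> ?thesis"
    then have shift: "take k (drop 1 xs) = take k xs" if "xs \<in> L" for xs
      using that by blast
    have const: "xs ! i = xs ! 0" if "xs \<in> L" "i < k" for xs i
      using that(2)
    proof (induction i)
      case (Suc i)
      \<comment> \<open>Read at index \<open>i\<close>, the shift equation says that
        \<open>xs ! Suc i = xs ! i\<close>.\<close>
      then have "take k (drop 1 xs) ! i = take k xs ! i"
        using shift[OF that(1)] by simp
      with Suc show ?case
        using len[OF that(1)] \<open>k < n\<close> by simp
    qed simp
    \<comment> \<open>The first symbol determines the constant prefix, and by \<open>inj\<close> the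
      prefix determines the word.\<close>
    have "inj_on (\<lambda>xs. xs ! 0) L"
    proof (rule inj_onI)
      fix xs ys assume xy: "xs \<in> L" "ys \<in> L" "xs ! 0 = ys ! 0"
      have "take k xs = take k ys"
      proof (rule nth_equalityI)
        show "length (take k xs) = length (take k ys)"
          using xy len by simp
        fix i assume "i < length (take k xs)"
        then have "i < k"
          by simp
        then show "take k xs ! i = take k ys ! i"
          using const[of xs i] const[of ys i] xy by simp
      qed
      then show "xs = ys"
        using inj xy by (auto dest: inj_onD)
    qed
    \<comment> \<open>The exponent 1 is kept visible so that comparing exponents yields
      \<open>k \<le> 1\<close>.\<close>
    then have "CARD('a) ^ k \<le> CARD('a) ^ 1"
      using card_inj_on_le[of "\<lambda>xs. xs ! 0" L "UNIV :: 'a set"] card_L by simp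
    then show False
      using \<open>2 \<le> k\<close> \<open>2 \<le> CARD('a)\<close> by (simp only: power_increasing_iff)
  qed
  then obtain xs where xs: "xs \<in> L" "take k (drop 1 xs) \<noteq> take k xs"
    by blast
  \<comment> \<open>Since \<open>k + 1 \<le> n\<close>, the window starting at index 1 has full
    length \<open>k\<close>.\<close>
  have "take k (drop 1 xs) \<in> ?W"
    using len[OF xs(1)] \<open>k < n\<close> by simp
  then obtain ys where ys: "ys \<in> L" "take k (drop 1 xs) = take k ys"
    using surj by (metis (no_types, lifting) imageE)
  then have "insdel_dist xs ys \<le> 2 * n - 2 * k"
    using insdel_dist_common_window[of xs n ys 1 k 0] len xs \<open>k < n\<close> by simp
  \<comment> \<open>Here \<open>xs \<noteq> ys\<close>, as the shifted window of \<open>xs\<close>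
    is the prefix of \<open>ys\<close> but not that of \<open>xs\<close>.\<close>
  then show ?thesis
    using xs ys by metis
qed

text \<open>Coordinates in a finite basis \<open>B\<close> identify the vectors with the functions
  from \<open>B\<close> to the scalars. Extensional functions are used because fixing the values
  outside \<open>B\<close> makes the coefficients unique.\<close>

lemma (in vectorspace) card_carrier_finite:
  assumes "finite (carrier V)"
  shows "card (carrier V) = card (carrier K) ^ dim"
proof -
  \<comment> \<open>The carrier is itself a finite spanning set, which gives finite dimension and
    hence a finite basis.\<close>
  have "span (carrier V) = carrier V"
    using in_own_span[of "carrier V"] span_is_subset2[of "carrier V"] by blast
  then have "fin_dim"
    unfolding fin_dim_def using assms by blast
  then obtain B where B: "finite B" "basis B"
    using finite_basis_exists by blast
  then have B_V: "B \<subseteq> carrier V"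
    by (simp add: basis_def)
  have ex1: "\<forall>v. v \<in> carrier V \<longrightarrow> (\<exists>!a. a \<in> B \<rightarrow>\<^sub>E carrier K \<and> lincomb a B = v)"
    using B(2) unfolding basis_criterion[OF B(1) B_V] .
  have closed: "lincomb a B \<in> carrier V" if "a \<in> B \<rightarrow>\<^sub>E carrier K" for a
    using that B_V by (intro lincomb_closed) auto
  have "bij_betw (\<lambda>a. lincomb a B) (B \<rightarrow>\<^sub>E carrier K) (carrier V)"
  proof (rule bij_betw_imageI)
    show "inj_on (\<lambda>a. lincomb a B) (B \<rightarrow>\<^sub>E carrier K)"
      using ex1 closed by (intro inj_onI) metis
    show "(\<lambda>a. lincomb a B) ` (B \<rightarrow>\<^sub>E carrier K) = carrier V"
      using ex1 closed by (auto simp: image_iff)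
  qed
  then have "card (carrier V) = card (B \<rightarrow>\<^sub>E carrier K)"
    by (simp add: bij_betw_same_card)
  then show ?thesis
    using B by (simp add: card_PiE dim_basis)
qed

lemma inj_list_of_vec: "inj list_of_vec"
  by (rule injI) (metis vec_list)

lemma finite_carrier_vec: "finite (carrier_vec n :: 'a::finite vec set)"
proof (rule inj_on_finite)
  show "inj_on list_of_vec (carrier_vec n :: 'a vec set)"
    using inj_list_of_vec by (rule inj_on_subset) simp
  show "list_of_vec ` carrier_vec n \<subseteq> {xs :: 'a list. set xs \<subseteq> UNIV \<and> length xs = n}"
    by auto
qed (rule finite_lists_length_eq, simp)

lemma linear_code_subset_carrier_vec:
  assumes "linear_code n k C"
  shows "C \<subseteq> carrier_vec n"
  using assms unfolding linear_code_def VectorSpace.subspace_def submodule_def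
  by (simp add: module_vec_simps)

text \<open>This turns the dimension into the word count on which the counting argument
  runs.\<close>

lemma card_linear_code:
  fixes C :: "'a::{field, finite} vec set"
  assumes "linear_code n k C"
  shows "card C = CARD('a) ^ k"
proof -
  have "finite C"
    using linear_code_subset_carrier_vec[OF assms] finite_carrier_vec by (rule finite_subset)
  moreover have "vectorspace class_ring (module_vec TYPE('a) n\<lparr>carrier := C\<rparr>)"
    using assms unfolding linear_code_def by (intro vectorspace.subspace_is_vs[OF vec_vs]) simp
  ultimately show ?thesis
    using vectorspace.card_carrier_finite assms unfolding linear_code_def by fastforce
qed

theorem theoremA:
  fixes C :: "'a::{field, finite} vec set" and n k :: nat
  assumes "2 \<le> k" and "k < n"
    and "linear_code n k C"
  shows "min_insdel_dist C \<le> 2 * n - 2 * k"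
proof -
  \<comment> \<open>In a field 0 and 1 differ, which gives the bound \<open>q \<ge> 2\<close> behind
    \<open>q < q ^ k\<close>.\<close>
  have "card {0, 1 :: 'a} \<le> CARD('a)"
    by (rule card_mono) simp_all
  then have "2 \<le> CARD('a)"
    by simp
  moreover have "length xs = n" if "xs \<in> list_of_vec ` C" for xs
    using that linear_code_subset_carrier_vec[OF assms(3)] by auto
  moreover have "card (list_of_vec ` C) = CARD('a) ^ k"
    using card_linear_code[OF assms(3)]
      card_image[OF inj_on_subset[OF inj_list_of_vec subset_UNIV], of C] by simp
  ultimately obtain c d where "c \<in> C" "d \<in> C" "c \<noteq> d"
    and dist: "insdel_dist (list_of_vec c) (list_of_vec d) \<le> 2 * n - 2 * k"
    using exists_insdel_dist_le[OF assms(1,2), of "list_of_vec ` C"] by blast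
  then have "min_insdel_dist C \<le> insdel_dist (list_of_vec c) (list_of_vec d)"
    unfolding min_insdel_dist_def by (intro cInf_lower) auto
  with dist show ?thesis
    by linarith
qed

end
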